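(* For every integer $n>0$, $\mathrm{sat}^*(n,\mathcal{D}_2)\geq\lceil\sqrt{n}\,\rceil$.
   Context: Let $[n]=\{1,\ldots,n\}$ and let $\mathcal{B}_n=(2^{[n]},\subseteq)$ be the $n$-dimensional Boolean lattice, i.e. the poset of all subsets of $[n]$ ordered by inclusion. A family $\mathcal{F}\subseteq 2^{[n]}$ is regarded as a poset under inclusion. A poset $(P,\preceq)$ is an induced subposet of (has an induced copy in) $\mathcal{F}$ if there is an injection $f:P\to\mathcal{F}$ such that $u\preceq v$ if and only if $f(u)\subseteq f(v)$. A family $\mathcal{F}\subseteq 2^{[n]}$ is induced-$\mathcal{P}$-saturated in $\mathcal{B}_n$ if $\mathcal{F}$ contains no induced copy of $\mathcal{P}$, but for every $S\in 2^{[n]}\setminus\mathcal{F}$ the family $\mathcal{F}\cup\{S\}$ contains an induced copy of $\mathcal{P}$. The induced saturation number $\mathrm{sat}^*(n,\mathcal{P})$ is the minimum size of a family that is induced-$\mathcal{P}$-saturated in $\mathcal{B}_n$. The diamond $\mathcal{D}_2$ is the 4-element poset $\{s,t_1,t_2,u\}$ with $s<t_1<u$ and $s<t_2<u$ (hence $s<u$), where $t_1$ and $t_2$ are incomparable. *)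

theory Defs
  imports Complex_Main
begin

text \<open>A poset is given by a (reflexive) partial order relation \<open>r\<close>
  whose carrier is \<open>Field r\<close>.\<close>

definition has_induced_copy :: "'a rel \<Rightarrow> nat set set \<Rightarrow> bool" where
  "has_induced_copy r F \<longleftrightarrow>
     (\<exists>f. inj_on f (Field r) \<and> f ` Field r \<subseteq> F \<and>
          (\<forall>u\<in>Field r. \<forall>v\<in>Field r. (u, v) \<in> r \<longleftrightarrow> f u \<subseteq> f v))"

definition induced_saturated :: "nat \<Rightarrow> 'a rel \<Rightarrow> nat set set \<Rightarrow> bool" where
  "induced_saturated n r F \<longleftrightarrow>
     F \<subseteq> Pow {1..n} \<and> \<not> has_induced_copy r F \<and>
     (\<forall>S\<in>Pow {1..n} - F. has_induced_copy r (insert S F))"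

text \<open>The minimum is attained whenever \<open>Field r\<close> is nonempty, see
  \<open>induced_saturated_exists\<close> below.\<close>

definition sat_star :: "nat \<Rightarrow> 'a rel \<Rightarrow> nat" where
  "sat_star n r = (LEAST k. \<exists>F. induced_saturated n r F \<and> card F = k)"

datatype diamond_elem = s | t1 | t2 | u

definition diamond :: "diamond_elem rel" where
  "diamond = Id \<union> {(s, t1), (s, t2), (s, u), (t1, u), (t2, u)}"

hide_const (open) s t1 t2 u

lemma Field_diamond: "Field diamond = UNIV"
  by (auto simp: diamond_def Field_def)

lemma partial_order_diamond: "partial_order_on UNIV diamond"
proof -
  have "refl diamond" by (simp add: refl_on_def diamond_def)
  moreover have "trans diamond" by (auto simp: trans_def diamond_def)
  moreover have "antisym diamond" by (auto simp: antisym_def diamond_def)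
  ultimately show ?thesis by (simp add: partial_order_on_def preorder_on_def)
qed

lemma induced_saturated_exists:
  assumes "Field r \<noteq> {}"
  shows "\<exists>F. induced_saturated n r F"
proof -
  define A where "A = {F. F \<subseteq> Pow {1..n} \<and> \<not> has_induced_copy r F}"
  have "A \<subseteq> Pow (Pow {1..n})"
    unfolding A_def by blast
  then have "finite A"
    by (rule finite_subset) simp
  moreover have "{} \<in> A"
    using assms by (simp add: A_def has_induced_copy_def)
  then have "A \<noteq> {}"
    by blast
  ultimately have "\<exists>F\<in>A. \<forall>G\<in>A. F \<subseteq> G \<longrightarrow> F = G"
    by (rule finite_has_maximal)
  then obtain F where F: "F \<in> A" and max: "\<And>G. G \<in> A \<Longrightarrow> F \<subseteq> G \<Longrightarrow> F = G"
    by blast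
  have "has_induced_copy r (insert S F)" if S: "S \<in> Pow {1..n} - F" for S
  proof (rule ccontr)
    assume "\<not> has_induced_copy r (insert S F)"
    with F S have "insert S F \<in> A"
      unfolding A_def by simp
    from max[OF this] S show False by blast
  qed
  with F show ?thesis
    unfolding induced_saturated_def A_def by blast
qed

end

theory Submission imports Defs
begin

text \<open>The bound comes from a separation property: in a saturated family \<open>F\<close>, every ground element
  \<open>i\<close> is the difference \<open>A - B = {i}\<close> of two members of \<open>F\<close>. As a pair determines its difference,
  there are at least \<open>n\<close> pairs in \<open>F \<times> F\<close>, so \<open>n \<le> (card F)\<^sup>2\<close>.

  The feature of the diamond behind this is that it has no two comparable elements that relate in the
  same way to the remaining two elements. Consequently a diamond-free family stays diamond-free when
  a set \<open>S\<close> is added that is comparable to some member \<open>A\<close> and relates to all other members as \<open>A\<close>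
  does (\<open>insert_comparable_twin_diamond_free\<close>). In a saturated family such a twin \<open>S\<close> of \<open>A\<close> must
  therefore already be a member. If \<open>i\<close> were not separated, then removing \<open>i\<close> from a minimal member
  containing \<open>i\<close> would produce a twin outside \<open>F\<close>; if no member contains \<open>i\<close>, then adding \<open>i\<close> to
  a maximal member would produce one.\<close>

definition is_diamond :: "'a set \<Rightarrow> 'a set \<Rightarrow> 'a set \<Rightarrow> 'a set \<Rightarrow> bool" where
  "is_diamond X Y Z W \<longleftrightarrow>
     X \<subseteq> Y \<and> X \<subseteq> Z \<and> Y \<subseteq> W \<and> Z \<subseteq> W \<and> \<not> Y \<subseteq> Z \<and> \<not> Z \<subseteq> Y"

lemma is_diamond_swap: "is_diamond X Y Z W \<longleftrightarrow> is_diamond X Z Y W"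
  by (auto simp: is_diamond_def)

text \<open>Incomparability of the two middle sets already forces all four sets to be distinct and the
  inclusions to be strict, so four members in these inclusions form an induced copy.\<close>

lemma has_induced_copy_diamond_iff:
  "has_induced_copy diamond F \<longleftrightarrow> (\<exists>X\<in>F. \<exists>Y\<in>F. \<exists>Z\<in>F. \<exists>W\<in>F. is_diamond X Y Z W)"
proof
  assume "has_induced_copy diamond F"
  then obtain f where f: "range f \<subseteq> F" "\<And>a b. (a, b) \<in> diamond \<longleftrightarrow> f a \<subseteq> f b"
    unfolding has_induced_copy_def Field_diamond by auto
  have "is_diamond (f diamond_elem.s) (f diamond_elem.t1) (f diamond_elem.t2) (f diamond_elem.u)"
    unfolding is_diamond_def f(2)[symmetric] by (simp add: diamond_def)
  with f(1) show "\<exists>X\<in>F. \<exists>Y\<in>F. \<exists>Z\<in>F. \<exists>W\<in>F. is_diamond X Y Z W"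
    by blast
next
  assume "\<exists>X\<in>F. \<exists>Y\<in>F. \<exists>Z\<in>F. \<exists>W\<in>F. is_diamond X Y Z W"
  then obtain X Y Z W where mem: "X \<in> F" "Y \<in> F" "Z \<in> F" "W \<in> F"
    and d: "is_diamond X Y Z W" by blast
  define f where "f = case_diamond_elem X Y Z W"
  have "(a, b) \<in> diamond \<longleftrightarrow> f a \<subseteq> f b" for a b
    using d unfolding is_diamond_def f_def diamond_def
    by (cases a; cases b) auto
  moreover have "range f \<subseteq> F"
    using mem by (auto simp: f_def split: diamond_elem.split)
  moreover have "inj f"
  proof (rule injI)
    fix a b assume "f a = f b"
    then show "a = b"
      using d unfolding is_diamond_def f_def by (cases a; cases b) auto
  qed
  ultimately show "has_induced_copy diamond F"
    unfolding has_induced_copy_def Field_diamond by blast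
qed

text \<open>In a diamond through \<open>S\<close>, the set \<open>A\<close> cannot occur as well: any two elements of a diamond that
  are comparable are told apart by one of the middle elements. So replacing \<open>S\<close> by \<open>A\<close> turns the
  diamond into one inside \<open>F\<close>.\<close>

lemma insert_comparable_twin_diamond_free:
  assumes free: "\<not> has_induced_copy diamond F"
    and A: "A \<in> F"
    and comparable: "A \<subseteq> S \<or> S \<subseteq> A"
    and above: "\<And>B. B \<in> F \<Longrightarrow> B \<noteq> A \<Longrightarrow> S \<subseteq> B \<longleftrightarrow> A \<subseteq> B"
    and below: "\<And>B. B \<in> F \<Longrightarrow> B \<noteq> A \<Longrightarrow> B \<subseteq> S \<longleftrightarrow> B \<subseteq> A"
  shows "\<not> has_induced_copy diamond (insert S F)"
proof
  assume "has_induced_copy diamond (insert S F)"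
  then obtain X Y Z W where mem: "X \<in> insert S F" "Y \<in> insert S F" "Z \<in> insert S F" "W \<in> insert S F"
    and d: "is_diamond X Y Z W"
    unfolding has_induced_copy_diamond_iff by blast
  have no: "\<not> is_diamond X' Y' Z' W'" if "X' \<in> F" "Y' \<in> F" "Z' \<in> F" "W' \<in> F" for X' Y' Z' W'
    using free that unfolding has_induced_copy_diamond_iff by blast
  have distinct: "X \<noteq> Y" "X \<noteq> Z" "X \<noteq> W" "Y \<noteq> Z" "Y \<noteq> W" "Z \<noteq> W"
    using d by (auto simp: is_diamond_def)
  have middle: False
    if "is_diamond X' S Z' W'" "X' \<in> F" "Z' \<in> F" "W' \<in> F" for X' Z' W'
  proof -
    have "Z' \<noteq> A"
      using that(1) comparable by (auto simp: is_diamond_def)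
    moreover from this have "X' \<noteq> A" "W' \<noteq> A"
      using that(1) above[OF \<open>Z' \<in> F\<close>] below[OF \<open>Z' \<in> F\<close>] by (auto simp: is_diamond_def)
    ultimately have "is_diamond X' A Z' W'"
      using that above below by (simp add: is_diamond_def)
    with no A that show False by blast
  qed
  consider "X = S" | "Y = S" | "Z = S" | "W = S" | "X \<in> F" "Y \<in> F" "Z \<in> F" "W \<in> F"
    using mem by blast
  then show False
  proof cases
    case 1
    then have F: "Y \<in> F" "Z \<in> F" "W \<in> F"
      using mem distinct by auto
    then have "Y \<noteq> A" "Z \<noteq> A"
      using d 1 above[of Y] above[of Z] by (auto simp: is_diamond_def)
    then have "is_diamond A Y Z W"
      using d 1 F above by (auto simp: is_diamond_def)
    with no A F show False by blast
  next
    case 2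
    then show False
      using middle[of X Z W] d mem distinct by auto
  next
    case 3
    then show False
      using middle[of X Y W] d mem distinct is_diamond_swap[of X Y Z W] by auto
  next
    case 4
    then have F: "X \<in> F" "Y \<in> F" "Z \<in> F"
      using mem distinct by auto
    then have "Y \<noteq> A" "Z \<noteq> A"
      using d 4 below[of Y] below[of Z] by (auto simp: is_diamond_def)
    then have "is_diamond X Y Z A"
      using d 4 F below by (auto simp: is_diamond_def)
    with no A F show False by blast
  next
    case 5
    with no d show False by blast
  qed
qed

lemma saturated_comparable_twin_mem:
  assumes sat: "induced_saturated n diamond F"
    and "A \<in> F" "S \<subseteq> {1..n}"
    and "A \<subseteq> S \<or> S \<subseteq> A"
    and "\<And>B. B \<in> F \<Longrightarrow> B \<noteq> A \<Longrightarrow> S \<subseteq> B \<longleftrightarrow> A \<subseteq> B"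
    and "\<And>B. B \<in> F \<Longrightarrow> B \<noteq> A \<Longrightarrow> B \<subseteq> S \<longleftrightarrow> B \<subseteq> A"
  shows "S \<in> F"
proof (rule ccontr)
  assume "S \<notin> F"
  with sat \<open>S \<subseteq> {1..n}\<close> have "has_induced_copy diamond (insert S F)"
    unfolding induced_saturated_def by blast
  moreover have "\<not> has_induced_copy diamond F"
    using sat unfolding induced_saturated_def by blast
  ultimately show False
    using insert_comparable_twin_diamond_free[of F A S] assms by blast
qed

lemma saturated_diamond_nonempty:
  assumes "induced_saturated n diamond F"
  shows "F \<noteq> {}"
proof
  assume "F = {}"
  with assms have "has_induced_copy diamond {{}}"
    unfolding induced_saturated_def by blast
  then show False
    by (simp add: has_induced_copy_diamond_iff is_diamond_def)
qed

text \<open>Without separation at \<open>i\<close>, a member \<open>B\<close> with \<open>A - {i} \<subseteq> B\<close> must contain all of \<open>A\<close>, and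
  minimality of \<open>A\<close> among the members containing \<open>i\<close> says that proper subsets of \<open>A\<close> in \<open>F\<close> avoid
  \<open>i\<close>. These are precisely the two twin conditions for \<open>A\<close> and \<open>A - {i}\<close>.\<close>

lemma saturated_diamond_separates:
  assumes sat: "induced_saturated n diamond F" and i: "i \<in> {1..n}"
  shows "\<exists>A\<in>F. \<exists>B\<in>F. A - B = {i}"
proof (rule ccontr)
  assume nosep: "\<not> (\<exists>A\<in>F. \<exists>B\<in>F. A - B = {i})"
  have Pow: "F \<subseteq> Pow {1..n}"
    using sat unfolding induced_saturated_def by blast
  then have fin: "finite F"
    by (rule finite_subset) simp
  show False
  proof (cases "\<exists>A\<in>F. i \<in> A")
    case True
    then have "{A \<in> F. i \<in> A} \<noteq> {}" by blast
    with fin have "\<exists>A\<in>{A \<in> F. i \<in> A}. \<forall>B\<in>{A \<in> F. i \<in> A}. B \<subseteq> A \<longrightarrow> A = B"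
      by (intro finite_has_minimal) auto
    then obtain A where A: "A \<in> F" "i \<in> A"
      and min: "\<And>B. B \<in> F \<Longrightarrow> i \<in> B \<Longrightarrow> B \<subseteq> A \<Longrightarrow> A = B" by blast
    have "A - {i} \<in> F"
    proof (rule saturated_comparable_twin_mem[OF sat \<open>A \<in> F\<close>])
      show "A - {i} \<subseteq> {1..n}" using Pow A by blast
      show "A \<subseteq> A - {i} \<or> A - {i} \<subseteq> A" by blast
    next
      fix B assume B: "B \<in> F" "B \<noteq> A"
      have "A - B \<noteq> {i}" using nosep A B by blast
      then show "A - {i} \<subseteq> B \<longleftrightarrow> A \<subseteq> B" using A(2) by blast
      show "B \<subseteq> A - {i} \<longleftrightarrow> B \<subseteq> A" using min[of B] B by blast
    qed
    moreover have "A - (A - {i}) = {i}" using A by blast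
    ultimately show False using nosep A by blast
  next
    case False
    from fin saturated_diamond_nonempty[OF sat]
    have "\<exists>A\<in>F. \<forall>B\<in>F. A \<subseteq> B \<longrightarrow> A = B"
      by (rule finite_has_maximal)
    then obtain A where A: "A \<in> F" and max: "\<And>B. B \<in> F \<Longrightarrow> A \<subseteq> B \<Longrightarrow> A = B" by blast
    have "insert i A \<in> F"
    proof (rule saturated_comparable_twin_mem[OF sat \<open>A \<in> F\<close>])
      show "insert i A \<subseteq> {1..n}" using Pow A i by blast
      show "A \<subseteq> insert i A \<or> insert i A \<subseteq> A" by blast
    next
      fix B assume B: "B \<in> F" "B \<noteq> A"
      show "insert i A \<subseteq> B \<longleftrightarrow> A \<subseteq> B" using max[of B] B by blast
      show "B \<subseteq> insert i A \<longleftrightarrow> B \<subseteq> A" using False B by blast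
    qed
    with False show False by blast
  qed
qed

lemma card_saturated_diamond:
  assumes sat: "induced_saturated n diamond F"
  shows "n \<le> (card F)\<^sup>2"
proof -
  have "finite F"
    using sat finite_subset[of F "Pow {1..n}"] unfolding induced_saturated_def by auto
  have "(\<lambda>i. {i}) ` {1..n} \<subseteq> (\<lambda>(A, B). A - B) ` (F \<times> F)"
  proof (rule image_subsetI)
    fix i assume "i \<in> {1..n}"
    from saturated_diamond_separates[OF sat this]
    obtain A B where "A \<in> F" "B \<in> F" "A - B = {i}" by blast
    then show "{i} \<in> (\<lambda>(A, B). A - B) ` (F \<times> F)"
      by (intro image_eqI[where x = "(A, B)"]) auto
  qed
  then have "card ((\<lambda>i. {i}) ` {1..n}) \<le> card (F \<times> F)"
    using \<open>finite F\<close> by (intro surj_card_le finite_cartesian_product)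
  then show ?thesis
    by (simp add: card_image card_cartesian_product power2_eq_square)
qed

theorem theorem6:
  fixes n :: nat
  assumes "n > 0"
  shows "int (sat_star n diamond) \<ge> \<lceil>sqrt (real n)\<rceil>"
proof -
  have "\<exists>F. induced_saturated n diamond F"
    by (rule induced_saturated_exists) (simp add: Field_diamond)
  then have "\<exists>k F. induced_saturated n diamond F \<and> card F = k"
    by blast
  then have "\<exists>F. induced_saturated n diamond F \<and> card F = sat_star n diamond"
    unfolding sat_star_def by (rule LeastI_ex)
  then have "n \<le> (sat_star n diamond)\<^sup>2"
    using card_saturated_diamond by metis
  then have "real n \<le> (real (sat_star n diamond))\<^sup>2"
    by (metis of_nat_le_iff of_nat_power)
  then have "sqrt (real n) \<le> real (sat_star n diamond)"
    by (intro real_le_lsqrt) auto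
  then show ?thesis
    by (simp add: ceiling_le_iff)
qed

end
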